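(* Let $G$ be an abelian group, $\phi\in\mathrm{End}(G)$, $H$ a $\phi$-invariant subgroup of $G$, and $\overline\phi\in\mathrm{End}(G/H)$ the endomorphism induced by $\phi$. Then $$h(\phi)=h(\phi\restriction_H)+h(\overline\phi).$$
   Context: $\mathbb N_+$ is the set of positive integers. A subgroup $H$ of $G$ is $\phi$-invariant if $\phi(H)\subseteq H$. For an abelian group $G$, $[G]^{<\omega}$ denotes the family of all non-empty finite subsets of $G$. For $\phi\in\mathrm{End}(G)$, $F\in[G]^{<\omega}$ and $n\in\mathbb N_+$ let $T_n(\phi,F)=F+\phi(F)+\ldots+\phi^{n-1}(F)$ and $H(\phi,F)=\lim_{n\to\infty}\frac{\log|T_n(\phi,F)|}{n}$ (this limit always exists). The algebraic entropy of $\phi$ is $h(\phi)=\sup\{H(\phi,F):F\in[G]^{<\omega}\}\in[0,\infty]$. Sums are taken in $[0,\infty]$, with $x+\infty=\infty$. *)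

theory Defs
  imports "HOL-Algebra.Coset" "HOL-Library.Extended_Nonnegative_Real"
begin

text \<open>
  Abelian groups are \<open>comm_group\<close> structures, so the sum \<open>A + B\<close> of two subsets is \<open>A <#>\<^bsub>G\<^esub> B\<close>.
  For \<open>n \<ge> 1\<close> and \<open>F \<subseteq> carrier G\<close>, \<open>trajectory G \<phi> n F\<close> is \<open>F + \<phi>(F) + \<dots> + \<phi>\<^sup>n\<^sup>-\<^sup>1(F)\<close>.
\<close>

primrec trajectory ::
  "('a, 'b) monoid_scheme \<Rightarrow> ('a \<Rightarrow> 'a) \<Rightarrow> nat \<Rightarrow> 'a set \<Rightarrow> 'a set"
where
  "trajectory G \<phi> 0 F = {\<one>\<^bsub>G\<^esub>}"
| "trajectory G \<phi> (Suc n) F = trajectory G \<phi> n F <#>\<^bsub>G\<^esub> (\<phi> ^^ n) ` F"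

definition entropy_wrt ::
  "('a, 'b) monoid_scheme \<Rightarrow> ('a \<Rightarrow> 'a) \<Rightarrow> 'a set \<Rightarrow> real"
where
  "entropy_wrt G \<phi> F = lim (\<lambda>n. ln (real (card (trajectory G \<phi> n F))) / real n)"

text \<open>
  The limit above is nonnegative for every nonempty finite \<open>F \<subseteq> carrier G\<close>, so the coercion
  \<open>ennreal\<close> below does not truncate.
\<close>

definition algebraic_entropy ::
  "('a, 'b) monoid_scheme \<Rightarrow> ('a \<Rightarrow> 'a) \<Rightarrow> ennreal"
where
  "algebraic_entropy G \<phi> =
     (SUP F \<in> {F. F \<subseteq> carrier G \<and> finite F \<and> F \<noteq> {}}. ennreal (entropy_wrt G \<phi> F))"

text \<open>
  The coset \<open>C = H + x\<close> is sent to \<open>H + \<phi>(C)\<close>, which for \<open>\<phi>\<close>-invariant \<open>H\<close> is the coset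
  \<open>H + \<phi>(x)\<close>; see \<open>induced_endo_coset\<close>.
\<close>

definition induced_endo ::
  "('a, 'b) monoid_scheme \<Rightarrow> 'a set \<Rightarrow> ('a \<Rightarrow> 'a) \<Rightarrow> 'a set \<Rightarrow> 'a set"
where
  "induced_endo G H \<phi> = (\<lambda>C \<in> carrier (G Mod H). H <#>\<^bsub>G\<^esub> \<phi> ` C)"

lemma induced_endo_coset:
  fixes G (structure)
  assumes "group G" "\<phi> \<in> hom G G" "subgroup H G" "\<phi> ` H \<subseteq> H" "x \<in> carrier G"
  shows "induced_endo G H \<phi> (H #> x) = H #> \<phi> x"
proof -
  interpret group G by fact
  interpret H: subgroup H G by fact
  have \<phi>x: "\<phi> x \<in> carrier G"
    using assms(2,5) by (rule hom_in_carrier)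
  have img: "\<phi> (h \<otimes> x) = \<phi> h \<otimes> \<phi> x" if "h \<in> H" for h
    using hom_mult[OF assms(2)] that assms(5) by auto
  have "H <#> \<phi> ` (H #> x) = H #> \<phi> x"
  proof
    show "H <#> \<phi> ` (H #> x) \<subseteq> H #> \<phi> x"
    proof
      fix y assume "y \<in> H <#> \<phi> ` (H #> x)"
      then obtain k h where kh: "k \<in> H" "h \<in> H" "y = k \<otimes> \<phi> (h \<otimes> x)"
        by (auto simp: set_mult_def r_coset_def)
      moreover have "\<phi> h \<in> H" using assms(4) kh by blast
      ultimately have "y = (k \<otimes> \<phi> h) \<otimes> \<phi> x" "k \<otimes> \<phi> h \<in> H"
        using img \<phi>x by (auto simp: m_assoc)
      then show "y \<in> H #> \<phi> x"
        by (auto simp: r_coset_def)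
    qed
    show "H #> \<phi> x \<subseteq> H <#> \<phi> ` (H #> x)"
    proof
      fix y assume "y \<in> H #> \<phi> x"
      then obtain k where "k \<in> H" "y = k \<otimes> \<phi> x"
        by (auto simp: r_coset_def)
      moreover have "x \<in> H #> x"
        using assms(3,5) rcos_self by blast
      ultimately show "y \<in> H <#> \<phi> ` (H #> x)"
        by (auto simp: set_mult_def)
    qed
  qed
  moreover have "H #> x \<in> carrier (G Mod H)"
    using assms(5) by (auto simp: FactGroup_def RCOSETS_def)
  ultimately show ?thesis
    by (simp add: induced_endo_def)
qed

lemma induced_endo_hom:
  fixes G (structure)
  assumes "comm_group G" "\<phi> \<in> hom G G" "subgroup H G" "\<phi> ` H \<subseteq> H"
  shows "induced_endo G H \<phi> \<in> hom (G Mod H) (G Mod H)"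
proof -
  interpret comm_group G by fact
  interpret H: normal H G
    using assms(3) by (rule subgroup_imp_normal)
  note coset = induced_endo_coset[OF is_group assms(2-4)]
  show ?thesis
    using assms(2)
    by (auto simp: hom_def FactGroup_def RCOSETS_def H.rcos_sum coset Pi_iff)
qed

end

theory Submission
  imports Defs
begin

text \<open>
  Write \<open>\<pi>\<close> for the projection to \<open>G/H\<close> and \<open>T\<^sub>n\<close> for the trajectories.
  For \<open>\<ge>\<close>, every fibre of \<open>\<pi>\<close> over \<open>\<pi>(T\<^sub>n(B))\<close> contains a translate of \<open>T\<^sub>n(A)\<close> inside
  \<open>T\<^sub>n(A + B)\<close> when \<open>A \<subseteq> H\<close>.
  For \<open>\<le>\<close>, fix \<open>m\<close>, let \<open>S\<close> be a set of representatives in \<open>T\<^sub>m(F)\<close> of \<open>\<pi>(T\<^sub>m(F))\<close>, and let \<open>E\<close> be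
  the finite set of differences of elements of \<open>T\<^sub>m(F)\<close> that lie in \<open>H\<close>, so that
  \<open>T\<^sub>m(F) \<subseteq> S + E\<close>. Applying \<open>\<phi>\<^sup>j\<^sup>m\<close> and summing over \<open>j < k\<close> bounds \<open>|T\<^sub>k\<^sub>m(F)|\<close> by
  \<open>|\<pi>(T\<^sub>m(F))|\<^sup>k |T\<^sub>k\<^sub>m(E)|\<close>. Letting \<open>k \<rightarrow> \<infinity>\<close> and then \<open>m \<rightarrow> \<infinity>\<close> gives the inequality.
\<close>

section \<open>Subadditive sequences\<close>

lemma subadditive_le_mult:
  fixes a :: "nat \<Rightarrow> real"
  assumes "\<And>m n. a (m + n) \<le> a m + a n" and "a 0 \<le> 0"
  shows "a (k * m) \<le> real k * a m"
proof (induction k)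
  case (Suc k)
  then show ?case
    using assms(1)[of m "k * m"] by (simp add: algebra_simps)
qed (use assms in simp)

text \<open>Fekete's lemma. Nonnegativity makes the infimum \<open>L\<close> of the quotients
  finite. An index \<open>m\<close> whose quotient is nearly \<open>L\<close> controls every large
  \<open>n\<close> through division with remainder by \<open>m\<close>.\<close>

lemma subadditive_convergent:
  fixes a :: "nat \<Rightarrow> real"
  assumes sub: "\<And>m n. a (m + n) \<le> a m + a n" and nonneg: "\<And>n. 0 \<le> a n" and "a 0 = 0"
  shows "convergent (\<lambda>n. a n / real n)"
proof -
  define L where "L = (INF n\<in>{1..}. a n / real n)"
  have bdd: "bdd_below ((\<lambda>n. a n / real n) ` {1..})"
    using nonneg by (intro bdd_belowI[of _ 0]) auto
  have lower: "L \<le> a n / real n" if "n \<ge> 1" for n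
    unfolding L_def using bdd that by (intro cINF_lower) auto
  have "(\<lambda>n. a n / real n) \<longlonglongrightarrow> L"
  proof (rule LIMSEQ_I)
    fix e :: real assume e: "e > 0"
    have "\<exists>x\<in>(\<lambda>n. a n / real n) ` {1..}. x < L + e / 2"
      unfolding L_def using e by (intro cInf_lessD) auto
    then obtain m where m: "m \<ge> 1" "a m / real m < L + e / 2"
      by auto
    \<comment> \<open>A bound for the remainder term \<open>a (n mod m)\<close> that does not depend
      on \<open>n\<close>, so its share vanishes after division by \<open>n\<close>.\<close>
    define M where "M = (\<Sum>r<m. a r)"
    have M: "a r \<le> M" if "r < m" for r
      unfolding M_def using that nonneg by (intro member_le_sum) auto
    obtain N :: nat where N: "real N > 2 * M / e"
      using reals_Archimedean2 by blast
    show "\<exists>N. \<forall>n\<ge>N. norm (a n / real n - L) < e"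
    proof (intro exI allI impI)
      \<comment> \<open>This fixes \<open>max 1 N\<close> as the existential witness; the 1 excludes
        \<open>n = 0\<close>, where the quotient is 0 by convention.\<close>
      fix n assume n: "n \<ge> max 1 N"
      have "a n \<le> a (n div m * m) + a (n mod m)"
        using sub[of "n div m * m" "n mod m"] by simp
      also have "\<dots> \<le> real (n div m) * a m + M"
        using subadditive_le_mult[of a "n div m" m] sub \<open>a 0 = 0\<close> M[of "n mod m"] m by force
      also have "\<dots> \<le> real n / real m * a m + M"
        using of_nat_div_le_of_nat[of n m, where 'a = real] nonneg by (intro add_mono mult_right_mono) auto
      finally have "a n / real n \<le> (real n / real m * a m + M) / real n"
        by (simp add: divide_right_mono)
      also have "\<dots> = a m / real m + M / real n"
        using n by (simp add: field_simps)
      finally have 1: "a n / real n \<le> a m / real m + M / real n" .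
      have "2 * M / e < real n"
        using N n by linarith
      then have "M / real n < e / 2"
        using e n by (simp add: field_simps)
      moreover have "L \<le> a n / real n"
        using lower n by simp
      ultimately show "norm (a n / real n - L) < e"
        using 1 m(2) \<open>L \<le> a n / real n\<close> unfolding real_norm_def abs_less_iff by linarith
    qed
  qed
  then show ?thesis
    by (rule convergentI)
qed

section \<open>Products of sets\<close>

lemma finite_set_mult:
  assumes "finite A" "finite B"
  shows "finite (A <#>\<^bsub>G\<^esub> B)"
  using assms by (auto simp: set_mult_def)

lemma card_set_mult_le:
  assumes "finite A" "finite B"
  shows "card (A <#>\<^bsub>G\<^esub> B) \<le> card A * card B"
proof -
  have "A <#>\<^bsub>G\<^esub> B = (\<lambda>(a, b). a \<otimes>\<^bsub>G\<^esub> b) ` (A \<times> B)"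
    by (auto simp: set_mult_def)
  then show ?thesis
    using assms by (metis card_cartesian_product card_image_le finite_cartesian_product)
qed

lemma (in comm_group) set_mult_swap_middle:
  assumes "A \<subseteq> carrier G" "B \<subseteq> carrier G" "C \<subseteq> carrier G" "D \<subseteq> carrier G"
  shows "(A <#> B) <#> (C <#> D) = (A <#> C) <#> (B <#> D)"
proof -
  have "(A <#> B) <#> (C <#> D) = A <#> ((B <#> C) <#> D)"
    using assms by (simp add: set_mult_assoc set_mult_closed)
  also have "B <#> C = C <#> B"
    using assms by (auto simp: set_mult_def subset_iff) (metis m_comm)+
  also have "A <#> ((C <#> B) <#> D) = (A <#> C) <#> (B <#> D)"
    using assms by (simp add: set_mult_assoc set_mult_closed)
  finally show ?thesis .
qed

text \<open>Trajectories never consult the carrier, which allows comparing \<open>G\<close> with a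
  subgroup. Agreement is asked of all iterates on \<open>F\<close>, since iterates may leave
  \<open>F\<close>.\<close>

lemma trajectory_cong:
  assumes "mult G = mult K" "one G = one K" "\<And>n x. x \<in> F \<Longrightarrow> (\<phi> ^^ n) x = (\<psi> ^^ n) x"
  shows "trajectory G \<phi> n F = trajectory K \<psi> n F"
  using assms by (induction n) (auto simp: set_mult_def)

section \<open>Trajectories of an endomorphism\<close>

locale comm_group_endo = comm_group G for G (structure) +
  fixes \<phi> :: "'a \<Rightarrow> 'a"
  assumes endo: "\<phi> \<in> hom G G"
begin

lemma funpow_endo: "\<phi> ^^ n \<in> hom G G"
proof (induction n)
  case 0
  then show ?case by (auto simp: hom_def)
next
  case (Suc n)
  then show ?case using endo by (auto simp: hom_def Pi_iff)
qed

lemma funpow_closed: "x \<in> carrier G \<Longrightarrow> (\<phi> ^^ n) x \<in> carrier G"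
  using funpow_endo by (rule hom_in_carrier)

lemma image_funpow_closed: "F \<subseteq> carrier G \<Longrightarrow> (\<phi> ^^ n) ` F \<subseteq> carrier G"
  using funpow_closed by blast

lemma funpow_one: "(\<phi> ^^ n) \<one> = \<one>"
  using hom_one[OF funpow_endo] is_group by blast

lemma trajectory_closed: "F \<subseteq> carrier G \<Longrightarrow> trajectory G \<phi> n F \<subseteq> carrier G"
  by (induction n) (simp_all add: set_mult_closed image_funpow_closed)

lemma finite_trajectory: "finite F \<Longrightarrow> finite (trajectory G \<phi> n F)"
  by (induction n) (auto intro: finite_set_mult)

lemma trajectory_nonempty: "F \<noteq> {} \<Longrightarrow> trajectory G \<phi> n F \<noteq> {}"
  by (induction n) (auto simp: set_mult_def)

lemma card_trajectory_pos:
  "finite F \<Longrightarrow> F \<noteq> {} \<Longrightarrow> 0 < card (trajectory G \<phi> n F)"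
  by (simp add: card_gt_0_iff finite_trajectory trajectory_nonempty)

text \<open>The iterate \<open>\<phi> ^^ n\<close> is a homomorphism, so it distributes over the
  product and shifts the second block by \<open>n\<close>. This is the source of
  subadditivity.\<close>

lemma trajectory_add:
  assumes F: "F \<subseteq> carrier G"
  shows "trajectory G \<phi> (n + m) F = trajectory G \<phi> n F <#> (\<phi> ^^ n) ` trajectory G \<phi> m F"
proof (induction m)
  case 0
  show ?case
    using trajectory_closed[OF F, of n] by (force simp: funpow_one set_mult_def)
next
  case (Suc m)
  have "(\<phi> ^^ n) ` trajectory G \<phi> (Suc m) F
      = (\<phi> ^^ n) ` trajectory G \<phi> m F <#> (\<phi> ^^ (n + m)) ` F"
    using set_mult_hom[OF funpow_endo trajectory_closed[OF F] image_funpow_closed[OF F]]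
    by (simp add: funpow_add image_comp)
  then show ?case
    using Suc F by (simp add: set_mult_assoc trajectory_closed image_funpow_closed)
qed

lemma trajectory_set_mult:
  assumes "A \<subseteq> carrier G" "B \<subseteq> carrier G"
  shows "trajectory G \<phi> n (A <#> B) = trajectory G \<phi> n A <#> trajectory G \<phi> n B"
proof (induction n)
  case 0
  show ?case by (auto simp: set_mult_def)
next
  case (Suc n)
  then show ?case
    using assms by (simp add: set_mult_hom[OF funpow_endo] set_mult_swap_middle
        trajectory_closed image_funpow_closed)
qed

text \<open>A shorter sum is padded with \<open>(\<phi> ^^ n) \<one> = \<one>\<close>.\<close>

lemma trajectory_mono_length:
  assumes "F \<subseteq> carrier G" "\<one> \<in> F" "n \<le> m"
  shows "trajectory G \<phi> n F \<subseteq> trajectory G \<phi> m F"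
proof (rule lift_Suc_mono_le[of "\<lambda>n. trajectory G \<phi> n F", OF _ \<open>n \<le> m\<close>])
  fix n
  show "trajectory G \<phi> n F \<subseteq> trajectory G \<phi> (Suc n) F"
  proof
    fix x assume x: "x \<in> trajectory G \<phi> n F"
    then have "x = x \<otimes> (\<phi> ^^ n) \<one>"
      using trajectory_closed[OF assms(1), of n] by (auto simp: funpow_one)
    then show "x \<in> trajectory G \<phi> (Suc n) F"
      using x assms(2) by (auto simp: set_mult_def)
  qed
qed

lemma card_trajectory_add_le:
  assumes "F \<subseteq> carrier G" "finite F"
  shows "card (trajectory G \<phi> (n + m) F) \<le> card (trajectory G \<phi> n F) * card (trajectory G \<phi> m F)"
proof -
  have "card (trajectory G \<phi> (n + m) F)
      \<le> card (trajectory G \<phi> n F) * card ((\<phi> ^^ n) ` trajectory G \<phi> m F)"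
    using assms by (simp add: trajectory_add card_set_mult_le finite_trajectory)
  also have "\<dots> \<le> card (trajectory G \<phi> n F) * card (trajectory G \<phi> m F)"
    using assms by (simp add: card_image_le finite_trajectory)
  finally show ?thesis .
qed

text \<open>Logarithms turn submultiplicativity of the cardinalities into subadditivity, and
  Fekete's lemma applies. Hence the \<open>lim\<close> in the definition of
  \<open>entropy_wrt\<close> is a genuine limit.\<close>

lemma entropy_wrt_tendsto:
  assumes "F \<subseteq> carrier G" "finite F" "F \<noteq> {}"
  shows "(\<lambda>n. ln (real (card (trajectory G \<phi> n F))) / real n) \<longlonglongrightarrow> entropy_wrt G \<phi> F"
proof -
  have pos: "0 < card (trajectory G \<phi> n F)" for n
    using assms card_trajectory_pos by blast
  have "convergent (\<lambda>n. ln (real (card (trajectory G \<phi> n F))) / real n)"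
  proof (rule subadditive_convergent)
    fix n m
    have "real (card (trajectory G \<phi> (n + m) F))
        \<le> real (card (trajectory G \<phi> n F)) * real (card (trajectory G \<phi> m F))"
      using card_trajectory_add_le[OF assms(1,2), of n m] by (metis of_nat_le_iff of_nat_mult)
    then show "ln (real (card (trajectory G \<phi> (n + m) F)))
        \<le> ln (real (card (trajectory G \<phi> n F))) + ln (real (card (trajectory G \<phi> m F)))"
      using pos by (simp flip: ln_mult_pos)
  next
    fix n
    show "0 \<le> ln (real (card (trajectory G \<phi> n F)))"
      using pos[of n] by simp
  qed simp
  then show ?thesis
    unfolding entropy_wrt_def by (simp add: convergent_LIMSEQ_iff)
qed

lemma entropy_wrt_nonneg:
  assumes "F \<subseteq> carrier G" "finite F" "F \<noteq> {}"
  shows "0 \<le> entropy_wrt G \<phi> F"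
proof (rule LIMSEQ_le_const[OF entropy_wrt_tendsto[OF assms]])
  show "\<exists>N. \<forall>n\<ge>N. 0 \<le> ln (real (card (trajectory G \<phi> n F))) / real n"
    using card_trajectory_pos[OF assms(2,3)] by (simp add: Suc_leI)
qed

lemma entropy_wrt_le_algebraic_entropy:
  assumes "F \<subseteq> carrier G" "finite F" "F \<noteq> {}"
  shows "ennreal (entropy_wrt G \<phi> F) \<le> algebraic_entropy G \<phi>"
  unfolding algebraic_entropy_def using assms by (intro SUP_upper) auto

end

section \<open>Restriction to an invariant subgroup and passage to the quotient\<close>

locale invariant_subgroup = comm_group_endo G \<phi> + H: subgroup H G
  for G (structure) and \<phi> and H +
  assumes invariant: "\<phi> ` H \<subseteq> H"
begin

abbreviation "G\<^sub>H \<equiv> G\<lparr>carrier := H\<rparr>"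
abbreviation "\<phi>\<^sub>H \<equiv> restrict \<phi> H"
abbreviation "\<pi> \<equiv> \<lambda>x. H #> x"
abbreviation "\<phi>\<^sub>Q \<equiv> induced_endo G H \<phi>"

sublocale H: normal H G
  using subgroup_imp_normal H.subgroup_axioms by blast

sublocale sub: comm_group_endo G\<^sub>H \<phi>\<^sub>H
proof -
  have "comm_group G\<^sub>H"
    using subgroup.subgroup_is_group[OF H.subgroup_axioms is_group] H.subset
    by (intro group.group_comm_groupI) (auto intro: m_comm)
  moreover have "\<phi>\<^sub>H \<in> hom G\<^sub>H G\<^sub>H"
    using invariant endo by (auto simp: hom_def)
  ultimately show "comm_group_endo G\<^sub>H \<phi>\<^sub>H"
    by (simp add: comm_group_endo_def comm_group_endo_axioms_def)
qed

sublocale quot: comm_group_endo "G Mod H" \<phi>\<^sub>Q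
proof -
  have "comm_group (G Mod H)"
    using H.subgroup_axioms by (rule abelian_FactGroup)
  moreover have "\<phi>\<^sub>Q \<in> hom (G Mod H) (G Mod H)"
    using induced_endo_hom endo H.subgroup_axioms invariant comm_group_axioms by blast
  ultimately show "comm_group_endo (G Mod H) \<phi>\<^sub>Q"
    by (simp add: comm_group_endo_def comm_group_endo_axioms_def)
qed

lemma funpow_restrict:
  assumes "x \<in> H"
  shows "(\<phi>\<^sub>H ^^ n) x = (\<phi> ^^ n) x" "(\<phi> ^^ n) x \<in> H"
proof -
  have "(\<phi>\<^sub>H ^^ n) x = (\<phi> ^^ n) x \<and> (\<phi> ^^ n) x \<in> H"
    using assms invariant by (induction n) auto
  then show "(\<phi>\<^sub>H ^^ n) x = (\<phi> ^^ n) x" "(\<phi> ^^ n) x \<in> H"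
    by auto
qed

lemma trajectory_subgroup:
  assumes "E \<subseteq> H"
  shows "trajectory G\<^sub>H \<phi>\<^sub>H n E = trajectory G \<phi> n E"
  using assms by (intro trajectory_cong) (auto simp: funpow_restrict)

lemma trajectory_subgroup_closed:
  assumes "E \<subseteq> H"
  shows "trajectory G \<phi> n E \<subseteq> H"
  using sub.trajectory_closed[of E n] assms by (simp add: trajectory_subgroup)

lemma funpow_induced_endo:
  assumes "x \<in> carrier G"
  shows "(\<phi>\<^sub>Q ^^ n) (\<pi> x) = \<pi> ((\<phi> ^^ n) x)"
proof (induction n)
  case (Suc n)
  then show ?case
    using induced_endo_coset[OF is_group endo H.subgroup_axioms invariant funpow_closed[OF assms]]
    by simp
qed simp

text \<open>The projection is a homomorphism and intertwines \<open>\<phi>\<close> with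
  \<open>\<phi>\<^sub>Q\<close>.\<close>

lemma trajectory_quotient:
  assumes F: "F \<subseteq> carrier G"
  shows "trajectory (G Mod H) \<phi>\<^sub>Q n (\<pi> ` F) = \<pi> ` trajectory G \<phi> n F"
proof (induction n)
  case 0
  then show ?case
    by (simp add: coset_mult_one H.subset FactGroup_def)
next
  case (Suc n)
  have "(\<phi>\<^sub>Q ^^ n) ` \<pi> ` F = \<pi> ` (\<phi> ^^ n) ` F"
    unfolding image_image using F by (intro image_cong refl funpow_induced_endo) blast
  then show ?case
    using Suc set_mult_hom[OF H.r_coset_hom_Mod trajectory_closed[OF F] image_funpow_closed[OF F]]
    by simp
qed

section \<open>Counting with coset representatives\<close>

lemma coset_section:
  assumes "T \<subseteq> carrier G"
  obtains s where "\<And>c. c \<in> \<pi> ` T \<Longrightarrow> s c \<in> T" "\<And>c. c \<in> \<pi> ` T \<Longrightarrow> \<pi> (s c) = c"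
proof -
  have "inv_into T \<pi> c \<in> T \<and> \<pi> (inv_into T \<pi> c) = c" if "c \<in> \<pi> ` T" for c
    using that by (simp add: inv_into_into f_inv_into_f)
  then show ?thesis
    using that by blast
qed

text \<open>With representatives \<open>s c\<close> chosen in \<open>B\<close>, the products
  \<open>a \<otimes> s c\<close> are pairwise distinct: the coset of the product recovers
  \<open>c\<close>, and cancellation then recovers \<open>a\<close>.\<close>

lemma card_set_mult_coset_ge:
  assumes "A \<subseteq> H" "finite A" "B \<subseteq> carrier G" "finite B"
  shows "card A * card (\<pi> ` B) \<le> card (A <#> B)"
proof -
  obtain s where s: "\<And>c. c \<in> \<pi> ` B \<Longrightarrow> s c \<in> B" "\<And>c. c \<in> \<pi> ` B \<Longrightarrow> \<pi> (s c) = c"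
    using coset_section assms(3) by metis
  have sc: "s c \<in> carrier G" if "c \<in> \<pi> ` B" for c
    using s(1)[OF that] assms(3) by blast
  have \<pi>: "\<pi> (a \<otimes> s c) = c" if "a \<in> A" "c \<in> \<pi> ` B" for a c
  proof -
    have "a \<in> H" using that assms(1) by blast
    then have "\<pi> (a \<otimes> s c) = \<pi> (s c)"
      using sc[OF that(2)] H.subset coset_mult_assoc[of H a "s c"] coset_join2[of a H]
        H.subgroup_axioms by auto
    then show ?thesis using s(2) that by simp
  qed
  have "inj_on (\<lambda>(a, c). a \<otimes> s c) (A \<times> \<pi> ` B)"
  proof (rule inj_onI, clarify)
    fix a b a' b' assume *: "a \<in> A" "b \<in> B" "a' \<in> A" "b' \<in> B" "a \<otimes> s (\<pi> b) = a' \<otimes> s (\<pi> b')"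
    then have "\<pi> b = \<pi> b'"
      using \<pi> by (metis imageI)
    moreover from this have "a = a'"
      using * sc[of "\<pi> b"] assms(1) H.subset by (metis imageI right_cancel subsetD)
    ultimately show "a = a' \<and> \<pi> b = \<pi> b'" by simp
  qed
  then have "card A * card (\<pi> ` B) = card ((\<lambda>(a, c). a \<otimes> s c) ` (A \<times> \<pi> ` B))"
    by (simp add: card_image card_cartesian_product)
  also have "\<dots> \<le> card (A <#> B)"
    using s(1) assms by (intro card_mono finite_set_mult) (force simp: set_mult_def)+
  finally show ?thesis .
qed

text \<open>Each \<open>t\<close> differs from the representative of its coset by an element of
  \<open>H\<close>. The unit is put on record in \<open>E\<close> so that trajectories of
  \<open>E\<close> grow with their length.\<close>

lemma subset_section_mult:
  assumes "T \<subseteq> carrier G" "finite T" "T \<noteq> {}"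
  obtains S E where "S \<subseteq> carrier G" "finite S" "card S \<le> card (\<pi> ` T)"
    "E \<subseteq> H" "finite E" "\<one> \<in> E" "T \<subseteq> S <#> E"
proof -
  obtain s where s: "\<And>c. c \<in> \<pi> ` T \<Longrightarrow> s c \<in> T" "\<And>c. c \<in> \<pi> ` T \<Longrightarrow> \<pi> (s c) = c"
    using coset_section assms(1) by metis
  define S where "S = s ` \<pi> ` T"
  \<comment> \<open>Differences of all pairs in \<open>T\<close> are formed, then cut down to
    \<open>H\<close>; finiteness of \<open>T\<close> passes to \<open>E\<close>.\<close>
  define E where "E = (\<lambda>(x, y). inv x \<otimes> y) ` (T \<times> T) \<inter> H"
  have "T \<subseteq> S <#> E"
  proof
    fix t assume t: "t \<in> T"
    define x where "x = s (\<pi> t)"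
    have x: "x \<in> T" "\<pi> x = \<pi> t" "x \<in> carrier G" "t \<in> carrier G"
      using s t assms(1) by (auto simp: x_def)
    have "t \<in> \<pi> x"
      using x H.subgroup_axioms rcos_self by metis
    then obtain h where h: "h \<in> H" "t = h \<otimes> x"
      by (auto simp: r_coset_def)
    then have "inv x \<otimes> t = h"
      using x H.subset by (metis H.mem_carrier inv_solve_left m_comm)
    then have "inv x \<otimes> t \<in> E"
      using t x h by (force simp: E_def)
    moreover have "x \<in> S"
      using t by (auto simp: S_def x_def)
    moreover have "t = x \<otimes> (inv x \<otimes> t)"
      using x by (simp flip: m_assoc)
    ultimately show "t \<in> S <#> E"
      by (auto simp: set_mult_def)
  qed
  moreover have "\<one> \<in> E"
  proof -
    obtain t where "t \<in> T" using assms(3) by blast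
    moreover from this have "inv t \<otimes> t = \<one>" using assms(1) by auto
    ultimately show ?thesis by (force simp: E_def)
  qed
  moreover have "S \<subseteq> carrier G" "finite S" "card S \<le> card (\<pi> ` T)"
    using s(1) assms by (auto simp: S_def card_image_le)
  moreover have "E \<subseteq> H" "finite E"
    using assms by (auto simp: E_def)
  ultimately show ?thesis
    using that by blast
qed

text \<open>The trajectory of length \<open>k * m\<close> splits into \<open>k\<close> shifted
  blocks of length \<open>m\<close>, each covered by a shift of \<open>S <#> E\<close>. The set
  \<open>C\<close> collects the shifts of \<open>S\<close>, each costing at most a factor
  \<open>card S\<close>; the shifts of \<open>E\<close> fit into one trajectory of
  \<open>E\<close>.\<close>

lemma card_trajectory_mult_le:
  assumes F: "F \<subseteq> carrier G" "finite F"
    and S: "S \<subseteq> carrier G" "finite S" and E: "E \<subseteq> H" "finite E" "\<one> \<in> E"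
    and cover: "trajectory G \<phi> m F \<subseteq> S <#> E" and "m \<ge> 1"
  shows "card (trajectory G \<phi> (k * m) F) \<le> card S ^ k * card (trajectory G \<phi> (k * m) E)"
proof -
  have EG: "E \<subseteq> carrier G"
    using E(1) H.subset by blast
  have "\<exists>C. C \<subseteq> carrier G \<and> finite C \<and> card C \<le> card S ^ k \<and>
      trajectory G \<phi> (k * m) F \<subseteq> C <#> trajectory G \<phi> (k * m) E"
  proof (induction k)
    case 0
    show ?case by (intro exI[of _ "{\<one>}"]) (auto simp: set_mult_def)
  next
    case (Suc k)
    then obtain C where C: "C \<subseteq> carrier G" "finite C" "card C \<le> card S ^ k"
        "trajectory G \<phi> (k * m) F \<subseteq> C <#> trajectory G \<phi> (k * m) E"
      by blast
    let ?f = "\<phi> ^^ (k * m)"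
    let ?C = "C <#> ?f ` S"
    have "trajectory G \<phi> (Suc k * m) F = trajectory G \<phi> (k * m) F <#> ?f ` trajectory G \<phi> m F"
      using trajectory_add[OF F(1), of "k * m" m] by (simp add: add.commute)
    also have "\<dots> \<subseteq> (C <#> trajectory G \<phi> (k * m) E) <#> ?f ` (S <#> E)"
      using C(4) cover by (intro mono_set_mult image_mono)
    also have "\<dots> = ?C <#> trajectory G \<phi> (Suc (k * m)) E"
      using C(1) S(1) EG by (simp add: set_mult_hom[OF funpow_endo] set_mult_swap_middle
          trajectory_closed image_funpow_closed)
    \<comment> \<open>The times strictly between multiples of \<open>m\<close> are filled in, using
      \<open>\<one> \<in> E\<close> and \<open>m \<ge> 1\<close>.\<close>
    also have "\<dots> \<subseteq> ?C <#> trajectory G \<phi> (Suc k * m) E"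
      using trajectory_mono_length[OF EG E(3), of "Suc (k * m)" "Suc k * m"] \<open>m \<ge> 1\<close>
      by (intro mono_set_mult) auto
    finally have "trajectory G \<phi> (Suc k * m) F \<subseteq> ?C <#> trajectory G \<phi> (Suc k * m) E" .
    moreover have "card ?C \<le> card S ^ Suc k"
    proof -
      have "card ?C \<le> card C * card (?f ` S)"
        using C S by (intro card_set_mult_le) auto
      also have "\<dots> \<le> card S ^ k * card S"
        using C S by (intro mult_mono card_image_le) auto
      finally show ?thesis by (simp add: mult.commute)
    qed
    moreover have "?C \<subseteq> carrier G" "finite ?C"
      using C S by (simp_all add: set_mult_closed image_funpow_closed finite_set_mult)
    ultimately show ?case by blast
  qed
  then obtain C where C: "finite C" "card C \<le> card S ^ k"
      "trajectory G \<phi> (k * m) F \<subseteq> C <#> trajectory G \<phi> (k * m) E"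
    by blast
  have "card (trajectory G \<phi> (k * m) F) \<le> card (C <#> trajectory G \<phi> (k * m) E)"
    using C E by (intro card_mono finite_set_mult finite_trajectory)
  also have "\<dots> \<le> card C * card (trajectory G \<phi> (k * m) E)"
    using C E by (intro card_set_mult_le finite_trajectory)
  also have "\<dots> \<le> card S ^ k * card (trajectory G \<phi> (k * m) E)"
    using C by simp
  finally show ?thesis .
qed

section \<open>The upper bound for the entropy of \<open>\<phi>\<close>\<close>

lemma image_coset_closed: "F \<subseteq> carrier G \<Longrightarrow> \<pi> ` F \<subseteq> carrier (G Mod H)"
  by (auto simp: FactGroup_def RCOSETS_def)

text \<open>The block estimate is divided by its length and \<open>k\<close> tends to infinity with
  \<open>m\<close> fixed. The quotient term is therefore still at finite stage \<open>m\<close>, and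
  \<open>E\<close> depends on \<open>m\<close>.\<close>

lemma entropy_wrt_le:
  assumes F: "F \<subseteq> carrier G" "finite F" "F \<noteq> {}" and m: "m \<ge> 1"
  obtains E where "E \<subseteq> H" "finite E" "E \<noteq> {}"
    "entropy_wrt G \<phi> F
      \<le> ln (real (card (trajectory (G Mod H) \<phi>\<^sub>Q m (\<pi> ` F)))) / real m + entropy_wrt G\<^sub>H \<phi>\<^sub>H E"
proof -
  let ?T = "trajectory G \<phi> m F"
  obtain S E where S: "S \<subseteq> carrier G" "finite S" "card S \<le> card (\<pi> ` ?T)"
    and E: "E \<subseteq> H" "finite E" "\<one> \<in> E" and cover: "?T \<subseteq> S <#> E"
    using subset_section_mult[of ?T] trajectory_closed[OF F(1)] finite_trajectory[OF F(2)]
      trajectory_nonempty[OF F(3)] by metis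
  have EG: "E \<subseteq> carrier G" "E \<noteq> {}"
    using E H.subset by auto
  define c where "c = card (\<pi> ` ?T)"
  have c: "c > 0"
    using trajectory_nonempty[OF F(3)] finite_trajectory[OF F(2)] by (simp add: c_def card_gt_0_iff)
  let ?a = "\<lambda>F n. ln (real (card (trajectory G \<phi> n F))) / real n"
  \<comment> \<open>Limits are taken along the positive multiples of \<open>m\<close>, so that
    \<open>Suc k\<close> cancels without division by zero.\<close>
  have sub: "strict_mono (\<lambda>k. Suc k * m)"
    using m by (auto simp: strict_mono_def)
  have "?a F (Suc k * m) \<le> ln (real c) / real m + ?a E (Suc k * m)" for k
  proof -
    let ?n = "Suc k * m"
    have "card (trajectory G \<phi> ?n F) \<le> card S ^ Suc k * card (trajectory G \<phi> ?n E)"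
      by (rule card_trajectory_mult_le[OF F(1,2) S(1,2) E cover m])
    also have "\<dots> \<le> c ^ Suc k * card (trajectory G \<phi> ?n E)"
      using S(3) unfolding c_def by (intro mult_right_mono power_mono) auto
    finally have "real (card (trajectory G \<phi> ?n F)) \<le> real c ^ Suc k * real (card (trajectory G \<phi> ?n E))"
      by (metis of_nat_le_iff of_nat_mult of_nat_power)
    then have "ln (real (card (trajectory G \<phi> ?n F)))
        \<le> ln (real c ^ Suc k * real (card (trajectory G \<phi> ?n E)))"
      using card_trajectory_pos[OF F(2,3), of ?n] by (intro ln_mono) auto
    also have "\<dots> = real (Suc k) * ln (real c) + ln (real (card (trajectory G \<phi> ?n E)))"
      using c card_trajectory_pos[OF E(2) EG(2), of ?n]
      by (subst ln_mult_pos) (simp_all only: ln_realpow of_nat_0_less_iff zero_less_power)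
    finally have "?a F ?n \<le> (real (Suc k) * ln (real c) + ln (real (card (trajectory G \<phi> ?n E)))) / real ?n"
      by (simp only: divide_right_mono of_nat_0_le_iff)
    also have "\<dots> = ln (real c) / real m + ?a E ?n"
      using m by (simp add: add_divide_distrib del: of_nat_Suc mult_Suc)
    finally show ?thesis .
  qed
  moreover have "(\<lambda>k. ?a F (Suc k * m)) \<longlonglongrightarrow> entropy_wrt G \<phi> F"
    using LIMSEQ_subseq_LIMSEQ[OF entropy_wrt_tendsto[OF F] sub] by (simp only: o_def)
  moreover have "(\<lambda>k. ln (real c) / real m + ?a E (Suc k * m)) \<longlonglongrightarrow> ln (real c) / real m + entropy_wrt G \<phi> E"
    using LIMSEQ_subseq_LIMSEQ[OF entropy_wrt_tendsto[OF EG(1) E(2) EG(2)] sub]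
    by (intro tendsto_add tendsto_const) (simp only: o_def)
  ultimately have "entropy_wrt G \<phi> F \<le> ln (real c) / real m + entropy_wrt G \<phi> E"
    by (intro LIMSEQ_le) auto
  moreover have "entropy_wrt G\<^sub>H \<phi>\<^sub>H E = entropy_wrt G \<phi> E"
    using E(1) by (simp add: entropy_wrt_def trajectory_subgroup)
  ultimately show ?thesis
    using that E EG(2) F(1) by (simp add: trajectory_quotient c_def)
qed

text \<open>Since \<open>E\<close> varies with \<open>m\<close>, its entropy is first replaced by
  the supremum \<open>r\<close> over \<open>H\<close>; only then can \<open>m\<close> tend to
  infinity. If that supremum is infinite, nothing is to be shown.\<close>

lemma algebraic_entropy_le:
  "algebraic_entropy G \<phi> \<le> algebraic_entropy G\<^sub>H \<phi>\<^sub>H + algebraic_entropy (G Mod H) \<phi>\<^sub>Q"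
proof (cases "algebraic_entropy G\<^sub>H \<phi>\<^sub>H")
  case (real r)
  show ?thesis
    unfolding algebraic_entropy_def[of G \<phi>]
  proof (rule SUP_least, clarify)
    fix F assume F: "F \<subseteq> carrier G" "finite F" "F \<noteq> {}"
    have FQ: "\<pi> ` F \<subseteq> carrier (G Mod H)" "finite (\<pi> ` F)" "\<pi> ` F \<noteq> {}"
      using F image_coset_closed by auto
    let ?a = "\<lambda>n. ln (real (card (trajectory (G Mod H) \<phi>\<^sub>Q n (\<pi> ` F)))) / real n"
    have "entropy_wrt G \<phi> F \<le> ?a m + r" if m: "m \<ge> 1" for m
    proof -
      obtain E where E: "E \<subseteq> H" "finite E" "E \<noteq> {}"
        and le: "entropy_wrt G \<phi> F \<le> ?a m + entropy_wrt G\<^sub>H \<phi>\<^sub>H E"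
        using entropy_wrt_le[OF F m] by blast
      have "ennreal (entropy_wrt G\<^sub>H \<phi>\<^sub>H E) \<le> ennreal r"
        using sub.entropy_wrt_le_algebraic_entropy[of E] E real by simp
      then show ?thesis
        using le real by (simp add: ennreal_le_iff)
    qed
    then have "entropy_wrt G \<phi> F \<le> entropy_wrt (G Mod H) \<phi>\<^sub>Q (\<pi> ` F) + r"
      by (intro LIMSEQ_le_const[OF tendsto_add[OF quot.entropy_wrt_tendsto[OF FQ] tendsto_const]]) blast
    then have "ennreal (entropy_wrt G \<phi> F) \<le> ennreal (entropy_wrt (G Mod H) \<phi>\<^sub>Q (\<pi> ` F) + r)"
      by (rule ennreal_leI)
    also have "\<dots> = ennreal r + ennreal (entropy_wrt (G Mod H) \<phi>\<^sub>Q (\<pi> ` F))"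
      using quot.entropy_wrt_nonneg[OF FQ] real by (simp add: add.commute)
    also have "\<dots> \<le> algebraic_entropy G\<^sub>H \<phi>\<^sub>H + algebraic_entropy (G Mod H) \<phi>\<^sub>Q"
      using quot.entropy_wrt_le_algebraic_entropy[OF FQ] real by (simp add: add_left_mono)
    finally show "ennreal (entropy_wrt G \<phi> F)
        \<le> algebraic_entropy G\<^sub>H \<phi>\<^sub>H + algebraic_entropy (G Mod H) \<phi>\<^sub>Q" .
  qed
qed simp

section \<open>The lower bound for the entropy of \<open>\<phi>\<close>\<close>

lemma entropy_wrt_add_le:
  assumes A: "A \<subseteq> H" "finite A" "A \<noteq> {}"
    and B: "B \<subseteq> carrier G" "finite B" "B \<noteq> {}"
  shows "entropy_wrt G\<^sub>H \<phi>\<^sub>H A + entropy_wrt (G Mod H) \<phi>\<^sub>Q (\<pi> ` B) \<le> entropy_wrt G \<phi> (A <#> B)"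
proof -
  have AG: "A \<subseteq> carrier G"
    using A(1) H.subset by blast
  have AB: "A <#> B \<subseteq> carrier G" "finite (A <#> B)" "A <#> B \<noteq> {}"
    using A B AG by (auto simp: set_mult_closed finite_set_mult) (auto simp: set_mult_def)
  have BQ: "\<pi> ` B \<subseteq> carrier (G Mod H)" "finite (\<pi> ` B)" "\<pi> ` B \<noteq> {}"
    using B image_coset_closed by auto
  let ?a = "\<lambda>n. ln (real (card (trajectory G\<^sub>H \<phi>\<^sub>H n A))) / real n"
  let ?b = "\<lambda>n. ln (real (card (trajectory (G Mod H) \<phi>\<^sub>Q n (\<pi> ` B)))) / real n"
  let ?c = "\<lambda>n. ln (real (card (trajectory G \<phi> n (A <#> B)))) / real n"
  have "?a n + ?b n \<le> ?c n" for n
  proof -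
    have pos: "0 < card (trajectory G\<^sub>H \<phi>\<^sub>H n A)" "0 < card (trajectory (G Mod H) \<phi>\<^sub>Q n (\<pi> ` B))"
      using sub.card_trajectory_pos A quot.card_trajectory_pos BQ by auto
    \<comment> \<open>The trajectory of \<open>A <#> B\<close> is the product of the two
      trajectories, and that of \<open>A\<close> stays in \<open>H\<close>, so coset counting
      applies.\<close>
    have "card (trajectory G\<^sub>H \<phi>\<^sub>H n A) * card (trajectory (G Mod H) \<phi>\<^sub>Q n (\<pi> ` B))
        \<le> card (trajectory G \<phi> n (A <#> B))"
      using card_set_mult_coset_ge[of "trajectory G \<phi> n A" "trajectory G \<phi> n B"] A B AG
      by (simp add: trajectory_subgroup trajectory_quotient trajectory_set_mult
          trajectory_subgroup_closed finite_trajectory trajectory_closed)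
    then have "real (card (trajectory G\<^sub>H \<phi>\<^sub>H n A)) * real (card (trajectory (G Mod H) \<phi>\<^sub>Q n (\<pi> ` B)))
        \<le> real (card (trajectory G \<phi> n (A <#> B)))"
      by (metis of_nat_le_iff of_nat_mult)
    then have "ln (real (card (trajectory G\<^sub>H \<phi>\<^sub>H n A)) * real (card (trajectory (G Mod H) \<phi>\<^sub>Q n (\<pi> ` B))))
        \<le> ln (real (card (trajectory G \<phi> n (A <#> B))))"
      using pos by (intro ln_mono) auto
    then show ?thesis
      using pos by (simp add: ln_mult divide_right_mono flip: add_divide_distrib)
  qed
  moreover have "?a \<longlonglongrightarrow> entropy_wrt G\<^sub>H \<phi>\<^sub>H A"
    using A by (intro sub.entropy_wrt_tendsto) auto
  ultimately show ?thesis
    by (intro LIMSEQ_le[OF tendsto_add[OF _ quot.entropy_wrt_tendsto[OF BQ]] entropy_wrt_tendsto[OF AB]])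
      blast+
qed

text \<open>A finite set of cosets lifts to a finite \<open>B\<close> in \<open>G\<close>, so every
  pair of competitors for \<open>H\<close> and the quotient yields one competitor
  \<open>A <#> B\<close> for \<open>G\<close>. The two suprema are then taken one after the
  other.\<close>

lemma algebraic_entropy_ge:
  "algebraic_entropy G\<^sub>H \<phi>\<^sub>H + algebraic_entropy (G Mod H) \<phi>\<^sub>Q \<le> algebraic_entropy G \<phi>"
proof -
  have *: "ennreal (entropy_wrt G\<^sub>H \<phi>\<^sub>H A) + ennreal (entropy_wrt (G Mod H) \<phi>\<^sub>Q C)
      \<le> algebraic_entropy G \<phi>"
    if A: "A \<subseteq> H" "finite A" "A \<noteq> {}" and C: "C \<subseteq> carrier (G Mod H)" "finite C" "C \<noteq> {}"
    for A C
  proof -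
    have "C \<subseteq> \<pi> ` carrier G"
      using C(1) by (auto simp: FactGroup_def RCOSETS_def)
    then obtain B where B: "B \<subseteq> carrier G" "finite B" "C = \<pi> ` B"
      using C(2) finite_subset_image by metis
    have "ennreal (entropy_wrt G\<^sub>H \<phi>\<^sub>H A) + ennreal (entropy_wrt (G Mod H) \<phi>\<^sub>Q C)
        = ennreal (entropy_wrt G\<^sub>H \<phi>\<^sub>H A + entropy_wrt (G Mod H) \<phi>\<^sub>Q C)"
      using sub.entropy_wrt_nonneg[of A] A quot.entropy_wrt_nonneg[of C] C by simp
    also have "\<dots> \<le> ennreal (entropy_wrt G \<phi> (A <#> B))"
      using entropy_wrt_add_le[of A B] A B C by (intro ennreal_leI) auto
    also have "\<dots> \<le> algebraic_entropy G \<phi>"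
    proof (rule entropy_wrt_le_algebraic_entropy)
      show "A <#> B \<subseteq> carrier G"
        using A B H.subset by (intro set_mult_closed) auto
      show "A <#> B \<noteq> {}"
        using A B C by (auto simp: set_mult_def)
    qed (use A B in \<open>auto intro: finite_set_mult\<close>)
    finally show ?thesis .
  qed
  \<comment> \<open>A constant summand can be moved inside a supremum in \<open>ennreal\<close> only
    over a nonempty index set; the singletons of the units provide this.\<close>
  let ?F = "\<lambda>K. {F. F \<subseteq> carrier K \<and> finite F \<and> F \<noteq> {}}"
  have "{\<one>} \<in> ?F G\<^sub>H" "{\<one>\<^bsub>G Mod H\<^esub>} \<in> ?F (G Mod H)"
    using quot.one_closed by simp_all
  then have ne: "?F G\<^sub>H \<noteq> {}" "?F (G Mod H) \<noteq> {}"
    by (metis empty_iff)+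
  have "ennreal (entropy_wrt G\<^sub>H \<phi>\<^sub>H A) + algebraic_entropy (G Mod H) \<phi>\<^sub>Q
      \<le> algebraic_entropy G \<phi>" if "A \<in> ?F G\<^sub>H" for A
    unfolding algebraic_entropy_def[of "G Mod H"] ennreal_SUP_add_right[OF ne(2)]
    using that by (intro SUP_least *) simp_all
  then show ?thesis
    unfolding algebraic_entropy_def[of G\<^sub>H] ennreal_SUP_add_left[OF ne(1), symmetric]
    by (rule SUP_least)
qed

end

theorem theorem1p1:
  fixes G :: "('a, 'b) monoid_scheme" and \<phi> :: "'a \<Rightarrow> 'a" and H :: "'a set"
  assumes "comm_group G"
    and "\<phi> \<in> hom G G"
    and "subgroup H G"
    and "\<phi> ` H \<subseteq> H"
  shows "algebraic_entropy G \<phi> =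
    algebraic_entropy (G\<lparr>carrier := H\<rparr>) (restrict \<phi> H)
      + algebraic_entropy (G Mod H) (induced_endo G H \<phi>)"
proof -
  interpret invariant_subgroup G \<phi> H
    using assms by (intro invariant_subgroup.intro invariant_subgroup_axioms.intro
        comm_group_endo.intro comm_group_endo_axioms.intro)
  show ?thesis
    by (rule antisym[OF algebraic_entropy_le algebraic_entropy_ge])
qed

end
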